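(* Let $d\in\{1,2\}$, $\varepsilon\ge0$, $T>0$, $p\ge 1$ an integer, $\boldsymbol\kappa\in\mathbb{R}^d\setminus\{0\}$, and let $\hat\mu_{\boldsymbol\kappa,\varepsilon}(t)$, $t\in[0,T]$, be the exact solution, i.e. $$\hat\mu_{\boldsymbol\kappa,\varepsilon}(t)=\hat\mu_{\boldsymbol\kappa,\varepsilon}(0)e^{i\omega_{\boldsymbol\kappa,\varepsilon}t}-\int_0^te^{i\omega_{\boldsymbol\kappa,\varepsilon}(t-\tau)}\hat g_{\boldsymbol\kappa}(\tau)\,d\tau .$$ For $\Delta t>0$ let $t^{(k)}=k\Delta t$ and let $(\hat\mu^{(k)}_{\boldsymbol\kappa,\varepsilon})_k$ be defined by the exponential integrator $$\hat\mu^{(k+1)}_{\boldsymbol\kappa,\varepsilon}=e^{i\omega_{\boldsymbol\kappa,\varepsilon}\Delta t}\left(\hat\mu^{(k)}_{\boldsymbol\kappa,\varepsilon}-\mathcal Q_{\boldsymbol\kappa,\Delta t}(t^{(k)})\right),$$ where the quadrature values $\mathcal Q_{\boldsymbol\kappa,\Delta t}(t^{(k)})\in\mathbb{C}$ satisfy, for all $\Delta t>0$ and $k\ge 0$ with $(k+1)\Delta t\le T$, $$\left|\mathcal Q_{\boldsymbol\kappa,\Delta t}(t^{(k)})-\int_0^{\Delta t}e^{-i\omega_{\boldsymbol\kappa,\varepsilon}\tau}\hat g_{\boldsymbol\kappa}(\tau+t^{(k)})\,d\tau\right|\le C^{(p)}_{\boldsymbol\kappa}\Delta t^{p+1},$$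 with a constant $C^{(p)}_{\boldsymbol\kappa}$ independent of $\Delta t$ and $k$. Assume that $\hat\mu^{(0)}_{\boldsymbol\kappa,\varepsilon}=\hat\mu_{\boldsymbol\kappa,\varepsilon}(0)$. Then for all $k\ge0$ and $\Delta t>0$ such that $k\Delta t\le T$, $$\left|\hat\mu^{(k)}_{\boldsymbol\kappa,\varepsilon}-\hat\mu_{\boldsymbol\kappa,\varepsilon}(k\Delta t)\right|\le T\,C^{(p)}_{\boldsymbol\kappa}\,\Delta t^{p}.$$
   Context: Constants: $0<\rho_1<\rho_2$, $h_1,h_2>0$, $g>0$ (gravitational acceleration); $|\cdot|_2$ is the Euclidean norm. For $\boldsymbol\kappa\ne0$, $$T_{j,\boldsymbol\kappa}=\rho_j\coth(2\pi|\boldsymbol\kappa|_2h_j)\ (j=1,2),\qquad \omega_{\boldsymbol\kappa}=\sqrt{\frac{2\pi|\boldsymbol\kappa|_2(\rho_2-\rho_1)g}{T_{1,\boldsymbol\kappa}+T_{2,\boldsymbol\kappa}}},\qquad \omega_{\boldsymbol\kappa,\varepsilon}=\omega_{\boldsymbol\kappa}+i\varepsilon .$$ The source term is $$\hat g_{\boldsymbol\kappa}(t)=\frac{2\pi\rho_1\, i\,\boldsymbol\kappa\cdot\boldsymbol U(t)\,e^{-2\pi i\boldsymbol\kappa\cdot X(t)}\hat f_{\boldsymbol\kappa}}{\sinh(2\pi|\boldsymbol\kappa|_2h_1)(T_{1,\boldsymbol\kappa}+T_{2,\boldsymbol\kappa})},$$ where $\boldsymbol U\in L^1(0,T;\mathbb{R}^d)$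 is the given ship velocity, $X(t)=\int_0^t\boldsymbol U(s)ds$, and $\hat f_{\boldsymbol\kappa}\in\mathbb{C}$ is the Fourier coefficient at $\boldsymbol\kappa$ of the ship-shape function $f$. *)

theory Defs
  imports "HOL-Analysis.Analysis"
begin

definition coth :: "real \<Rightarrow> real" where
  "coth x = cosh x / sinh x"

definition T_layer :: "real \<Rightarrow> real \<Rightarrow> real ^ 'd \<Rightarrow> real" where
  "T_layer \<rho> h \<kappa> = \<rho> * coth (2 * pi * norm \<kappa> * h)"

definition omega :: "real \<Rightarrow> real \<Rightarrow> real \<Rightarrow> real \<Rightarrow> real \<Rightarrow> real ^ 'd \<Rightarrow> real" where
  "omega \<rho>1 \<rho>2 h1 h2 g \<kappa> =
     sqrt (2 * pi * norm \<kappa> * (\<rho>2 - \<rho>1) * g / (T_layer \<rho>1 h1 \<kappa> + T_layer \<rho>2 h2 \<kappa>))"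

definition omega_eps ::
  "real \<Rightarrow> real \<Rightarrow> real \<Rightarrow> real \<Rightarrow> real \<Rightarrow> real \<Rightarrow> real ^ 'd \<Rightarrow> complex" where
  "omega_eps \<rho>1 \<rho>2 h1 h2 g \<epsilon> \<kappa> =
     complex_of_real (omega \<rho>1 \<rho>2 h1 h2 g \<kappa>) + \<i> * complex_of_real \<epsilon>"

definition ship_position :: "(real \<Rightarrow> real ^ 'd) \<Rightarrow> real \<Rightarrow> real ^ 'd" where
  "ship_position U t = (LINT s:{0..t}|lebesgue. U s)"

(* fhat is the map sending a wave vector to the corresponding Fourier coefficient of the
   ship shape; only its value at \<kappa> enters. *)
definition source ::
  "real \<Rightarrow> real \<Rightarrow> real \<Rightarrow> real \<Rightarrow> (real \<Rightarrow> real ^ 'd) \<Rightarrow> (real ^ 'd \<Rightarrow> complex)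
     \<Rightarrow> real ^ 'd \<Rightarrow> real \<Rightarrow> complex" where
  "source \<rho>1 \<rho>2 h1 h2 U fhat \<kappa> t =
     2 * of_real pi * of_real \<rho>1 * \<i> * of_real (\<kappa> \<bullet> U t)
       * exp (- 2 * of_real pi * \<i> * of_real (\<kappa> \<bullet> ship_position U t)) * fhat \<kappa>
     / of_real (sinh (2 * pi * norm \<kappa> * h1) * (T_layer \<rho>1 h1 \<kappa> + T_layer \<rho>2 h2 \<kappa>))"

end

theory Submission
  imports Defs
begin

text \<open>
  The exact solution obeys the integrator's recursion with the quadrature replaced by the exact
  integral, because Duhamel's formula restarts at every grid point. As the imaginary part of the
  frequency is nonnegative, multiplication by the propagator over one step does not increase
  moduli, so the local errors \<open>C \<Delta>t\<^sup>p\<^sup>+\<^sup>1\<close> merely add up over at most \<open>T / \<Delta>t\<close> steps.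
\<close>

text \<open>A continuous factor on a compact interval is measurable and bounded, and such a factor
  preserves absolute integrability.\<close>

lemma absolutely_integrable_continuous_mult_real:
  fixes f g :: "real \<Rightarrow> 'a :: {euclidean_space, real_normed_algebra}"
  assumes f: "continuous_on {a..b} f" and g: "g absolutely_integrable_on {a..b}"
  shows "(\<lambda>x. f x * g x) absolutely_integrable_on {a..b}"
proof (rule absolutely_integrable_bounded_measurable_product[where h = "(*)"])
  show "bilinear ((*) :: 'a \<Rightarrow> _)"
    using bounded_bilinear_mult bilinear_conv_bounded_bilinear by blast
  show "f \<in> borel_measurable (lebesgue_on {a..b})"
    using f by (rule continuous_imp_measurable_on_sets_lebesgue) simp
  show "bounded (f ` {a..b})"
    using f by (intro compact_imp_bounded compact_continuous_image) auto
qed (use g in auto)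

text \<open>Affine substitution of slope 1 on the whole line, with the interval encoded by its
  indicator. It moves the integral over one time step back to a step starting at 0.\<close>

lemma set_lebesgue_integral_shift_Icc:
  fixes f :: "real \<Rightarrow> 'a :: euclidean_space"
  shows "(LINT x:{a..b}|lebesgue. f (x + c)) = (LINT x:{a + c..b + c}|lebesgue. f x)"
proof -
  have "(LINT x:{a + c..b + c}|lebesgue. f x)
      = (LINT x|lebesgue. indicator {a + c..b + c} (c + 1 * x) *\<^sub>R f (c + 1 * x))"
    unfolding set_lebesgue_integral_def
    by (subst lebesgue_integral_real_affine[where c = 1 and t = c]) auto
  also have "\<dots> = (LINT x:{a..b}|lebesgue. f (x + c))"
    unfolding set_lebesgue_integral_def
    by (intro Bochner_Integration.integral_cong) (auto simp: indicator_def add.commute)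
  finally show ?thesis ..
qed

text \<open>Indefinite integrals of integrable functions are continuous. This makes the phase factor
  of the source continuous even though \<open>U\<close> itself is merely integrable.\<close>

lemma continuous_on_ship_position:
  assumes "U absolutely_integrable_on {0..T}"
  shows "continuous_on {0..T} (ship_position U)"
proof -
  have "continuous_on {0..T} (\<lambda>t. integral {0..t} U)"
    by (intro indefinite_integral_continuous_1 set_lebesgue_integral_eq_integral(1) assms)
  moreover have "ship_position U t = integral {0..t} U" if "t \<in> {0..T}" for t
    unfolding ship_position_def
    using that by (intro set_lebesgue_integral_eq_integral(2) absolutely_integrable_on_subinterval[OF assms]) auto
  ultimately show ?thesis
    using continuous_on_cong[OF refl, of "{0..T}" "ship_position U" "\<lambda>t. integral {0..t} U"] by blast
qed

text \<open>The source factors into a constant, a continuous phase, and a linear image of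
  \<open>U\<close>. Only the last factor can be unbounded, and it inherits integrability from
  \<open>U\<close>.\<close>

lemma source_absolutely_integrable:
  fixes U :: "real \<Rightarrow> real ^ 'd"
  assumes U: "U absolutely_integrable_on {0..T}"
  shows "source \<rho>1 \<rho>2 h1 h2 U fhat \<kappa> absolutely_integrable_on {0..T}"
proof -
  define c where "c = 2 * of_real pi * of_real \<rho>1 * \<i> * fhat \<kappa>
     / of_real (sinh (2 * pi * norm \<kappa> * h1) * (T_layer \<rho>1 h1 \<kappa> + T_layer \<rho>2 h2 \<kappa>))"
  have "((\<lambda>v. complex_of_real (\<kappa> \<bullet> v)) \<circ> U) absolutely_integrable_on {0..T}"
    by (intro absolutely_integrable_linear U
        bounded_linear_compose[OF bounded_linear_of_real bounded_linear_inner_right])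
  moreover have "continuous_on {0..T}
      (\<lambda>t. c * exp (- 2 * of_real pi * \<i> * of_real (\<kappa> \<bullet> ship_position U t)))"
    by (intro continuous_intros continuous_on_ship_position U)
  ultimately have "(\<lambda>t. (c * exp (- 2 * of_real pi * \<i> * of_real (\<kappa> \<bullet> ship_position U t)))
      * ((\<lambda>v. complex_of_real (\<kappa> \<bullet> v)) \<circ> U) t) absolutely_integrable_on {0..T}"
    by (intro absolutely_integrable_continuous_mult_real)
  also have "(\<lambda>t. (c * exp (- 2 * of_real pi * \<i> * of_real (\<kappa> \<bullet> ship_position U t)))
      * ((\<lambda>v. complex_of_real (\<kappa> \<bullet> v)) \<circ> U) t) = source \<rho>1 \<rho>2 h1 h2 U fhat \<kappa>"
    by (simp add: fun_eq_iff source_def c_def)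
  finally show ?thesis .
qed

text \<open>Split the Duhamel integral at \<open>a\<close>. Both pieces and the initial term contain
  the factor \<open>exp (z * of_real d)\<close>; once it is pulled out, the integral up to
  \<open>a\<close> and the initial term recombine to \<open>\<mu> a\<close>, and the rest is shifted
  to start at 0.\<close>

lemma duhamel_restart:
  fixes z :: complex and f :: "real \<Rightarrow> complex"
  assumes f: "f absolutely_integrable_on {0..T}" and "0 \<le> a" "0 \<le> d" "a + d \<le> T"
    and \<mu>: "\<And>t. t \<in> {0..T} \<Longrightarrow>
      \<mu> t = \<mu> 0 * exp (z * of_real t) - (LINT \<tau>:{0..t}|lebesgue. exp (z * of_real (t - \<tau>)) * f \<tau>)"
  shows "\<mu> (a + d) = exp (z * of_real d) *
    (\<mu> a - (LINT \<tau>:{0..d}|lebesgue. exp (- z * of_real \<tau>) * f (\<tau> + a)))"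
proof -
  define h where "h = (\<lambda>\<tau>. exp (z * of_real (a + d - \<tau>)) * f \<tau>)"
  have propagate: "exp (z * of_real (a + d - \<tau>)) * w
      = exp (z * of_real d) * (exp (z * of_real (a - \<tau>)) * w)" for \<tau> w
    by (simp add: exp_diff exp_add ring_distribs)
  have propagate_shifted: "exp (z * of_real (a + d - (\<tau> + a))) * w
      = exp (z * of_real d) * (exp (- z * of_real \<tau>) * w)" for \<tau> w
    by (simp add: exp_diff exp_minus field_simps)
  \<comment> \<open>Additivity over adjacent intervals is a fact about gauge integrals;
    integrability on each of the three intervals lets the Lebesgue integrals be exchanged for
    them.\<close>
  have h: "h absolutely_integrable_on {s..t}" if "0 \<le> s" "t \<le> T" for s t
    unfolding h_def
    by (rule absolutely_integrable_on_subinterval[where S = "{0..T}"])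
       (use that in \<open>auto intro!: absolutely_integrable_continuous_mult_real continuous_intros f\<close>)
  have "(LINT \<tau>:{0..a + d}|lebesgue. h \<tau>)
      = (LINT \<tau>:{0..a}|lebesgue. h \<tau>) + (LINT \<tau>:{a..a + d}|lebesgue. h \<tau>)"
    using assms(2-4) h
    by (simp add: set_lebesgue_integral_eq_integral Henstock_Kurzweil_Integration.integral_combine)
  also have "(LINT \<tau>:{0..a}|lebesgue. h \<tau>)
      = exp (z * of_real d) * (LINT \<tau>:{0..a}|lebesgue. exp (z * of_real (a - \<tau>)) * f \<tau>)"
    unfolding h_def set_integral_mult_right[symmetric]
    by (simp only: propagate)
  also have "(LINT \<tau>:{a..a + d}|lebesgue. h \<tau>) = (LINT \<tau>:{0..d}|lebesgue. h (\<tau> + a))"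
    by (simp add: set_lebesgue_integral_shift_Icc add.commute)
  also have "\<dots> = exp (z * of_real d) * (LINT \<tau>:{0..d}|lebesgue. exp (- z * of_real \<tau>) * f (\<tau> + a))"
    unfolding h_def set_integral_mult_right[symmetric]
    by (simp only: propagate_shifted)
  finally have *: "(LINT \<tau>:{0..a + d}|lebesgue. exp (z * of_real (a + d - \<tau>)) * f \<tau>) =
      exp (z * of_real d) * ((LINT \<tau>:{0..a}|lebesgue. exp (z * of_real (a - \<tau>)) * f \<tau>)
        + (LINT \<tau>:{0..d}|lebesgue. exp (- z * of_real \<tau>) * f (\<tau> + a)))"
    by (simp add: h_def distrib_left)
  have "exp (z * of_real (a + d)) = exp (z * of_real d) * exp (z * of_real a)"
    by (simp add: exp_add distrib_left)
  moreover have "\<mu> a = \<mu> 0 * exp (z * of_real a)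
      - (LINT \<tau>:{0..a}|lebesgue. exp (z * of_real (a - \<tau>)) * f \<tau>)"
    and "\<mu> (a + d) = \<mu> 0 * exp (z * of_real (a + d))
      - (LINT \<tau>:{0..a + d}|lebesgue. exp (z * of_real (a + d - \<tau>)) * f \<tau>)"
    by (rule \<mu>; use assms(2-4) in simp)+
  ultimately show ?thesis
    unfolding * by (simp only: mult.assoc mult.left_commute right_diff_distrib diff_diff_add)
qed

theorem proposition16:
  fixes \<rho>1 \<rho>2 h1 h2 g \<epsilon> T C :: real
    and p :: nat
    and \<kappa> :: "real ^ 'd"
    and U :: "real \<Rightarrow> real ^ 'd"
    and fhat :: "real ^ 'd \<Rightarrow> complex"
    and \<mu> :: "real \<Rightarrow> complex"
    and \<mu>num :: "real \<Rightarrow> nat \<Rightarrow> complex"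
    and Q :: "real \<Rightarrow> real \<Rightarrow> complex"
  assumes "0 < \<rho>1" and "\<rho>1 < \<rho>2" and "0 < h1" and "0 < h2" and "0 < g"
    and "CARD('d) \<in> {1, 2}"
    and "0 \<le> \<epsilon>" and "0 < T" and "1 \<le> p" and "\<kappa> \<noteq> 0"
    and "set_integrable lebesgue {0<..<T} U"
    and exact: "\<forall>t\<in>{0..T}.
      \<mu> t = \<mu> 0 * exp (\<i> * omega_eps \<rho>1 \<rho>2 h1 h2 g \<epsilon> \<kappa> * of_real t)
        - (LINT \<tau>:{0..t}|lebesgue.
             exp (\<i> * omega_eps \<rho>1 \<rho>2 h1 h2 g \<epsilon> \<kappa> * of_real (t - \<tau>))
               * source \<rho>1 \<rho>2 h1 h2 U fhat \<kappa> \<tau>)"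
    and integrator: "\<forall>\<Delta>t>0. \<forall>k. real (k + 1) * \<Delta>t \<le> T \<longrightarrow>
      \<mu>num \<Delta>t (k + 1) = exp (\<i> * omega_eps \<rho>1 \<rho>2 h1 h2 g \<epsilon> \<kappa> * of_real \<Delta>t)
        * (\<mu>num \<Delta>t k - Q \<Delta>t (real k * \<Delta>t))"
    and quadrature: "\<forall>\<Delta>t>0. \<forall>k. real (k + 1) * \<Delta>t \<le> T \<longrightarrow>
      cmod (Q \<Delta>t (real k * \<Delta>t)
        - (LINT \<tau>:{0..\<Delta>t}|lebesgue.
             exp (- \<i> * omega_eps \<rho>1 \<rho>2 h1 h2 g \<epsilon> \<kappa> * of_real \<tau>)
               * source \<rho>1 \<rho>2 h1 h2 U fhat \<kappa> (\<tau> + real k * \<Delta>t)))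
      \<le> C * \<Delta>t ^ (p + 1)"
    and initial: "\<forall>\<Delta>t>0. \<mu>num \<Delta>t 0 = \<mu> 0"
  shows "\<forall>k. \<forall>\<Delta>t>0. real k * \<Delta>t \<le> T \<longrightarrow>
    cmod (\<mu>num \<Delta>t k - \<mu> (real k * \<Delta>t)) \<le> T * C * \<Delta>t ^ p"
proof (intro allI impI)
  fix k :: nat and \<Delta>t :: real
  assume dt: "\<Delta>t > 0" and kT: "real k * \<Delta>t \<le> T"
  define z where "z = \<i> * omega_eps \<rho>1 \<rho>2 h1 h2 g \<epsilon> \<kappa>"
  define f where "f = source \<rho>1 \<rho>2 h1 h2 U fhat \<kappa>"
  \<comment> \<open>The two endpoints form a null set, so the open interval may be closed.\<close>
  have "U absolutely_integrable_on {0..T}"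
    by (rule absolutely_integrable_spike_set[OF \<open>set_integrable lebesgue {0<..<T} U\<close>])
       (rule negligible_subset[of "{0, T}"]; auto)+
  then have f: "f absolutely_integrable_on {0..T}"
    unfolding f_def by (rule source_absolutely_integrable)
  \<comment> \<open>The sign of \<open>C\<close> is read off from a single step of length
    \<open>T\<close>: there the quadrature bound dominates a modulus.\<close>
  have C: "0 \<le> C"
  proof -
    have "0 \<le> C * T ^ (p + 1)"
      by (rule order_trans[OF norm_ge_zero quadrature[rule_format, of T 0]]) (use \<open>0 < T\<close> in auto)
    with \<open>0 < T\<close> show ?thesis
      using zero_le_mult_iff[of C "T ^ (p + 1)"] zero_less_power[of T "p + 1"] by linarith
  qed
  \<comment> \<open>The real part of \<open>z\<close> is \<open>- \<epsilon>\<close>, so the modulus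
    is \<open>exp (- \<epsilon> * \<Delta>t)\<close>.\<close>
  have propagator: "cmod (exp (z * of_real \<Delta>t)) \<le> 1"
    using dt \<open>0 \<le> \<epsilon>\<close> by (simp add: z_def omega_eps_def)
  \<comment> \<open>Induction needs the bound that counts steps, since a bound with the final factor
    \<open>T\<close> leaves no room for one more local error. The time constraint stays inside the
    claim because it has to vary with \<open>k\<close>.\<close>
  have "real k * \<Delta>t \<le> T \<Longrightarrow>
    cmod (\<mu>num \<Delta>t k - \<mu> (real k * \<Delta>t)) \<le> real k * (C * \<Delta>t ^ (p + 1))"
  proof (induction k)
    case 0
    then show ?case using initial dt by simp
  next
    case (Suc k)
    define a where "a = real k * \<Delta>t"
    define J where "J = (LINT \<tau>:{0..\<Delta>t}|lebesgue. exp (- z * of_real \<tau>) * f (\<tau> + a))"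
    have a: "0 \<le> a" "a + \<Delta>t \<le> T" "real (Suc k) * \<Delta>t = a + \<Delta>t"
      using Suc.prems dt by (auto simp: a_def algebra_simps)
    have "\<mu> (a + \<Delta>t) = exp (z * of_real \<Delta>t) * (\<mu> a - J)"
      unfolding J_def
      using dt by (intro duhamel_restart[OF f a(1) _ a(2)] exact[folded z_def f_def, rule_format]) auto
    moreover have "\<mu>num \<Delta>t (Suc k) = exp (z * of_real \<Delta>t) * (\<mu>num \<Delta>t k - Q \<Delta>t a)"
      using integrator[rule_format, of \<Delta>t k] dt Suc.prems by (simp add: z_def a_def)
    \<comment> \<open>Both recursions share the propagator, so their difference is the propagated
      previous error minus the local quadrature error.\<close>
    ultimately have "cmod (\<mu>num \<Delta>t (Suc k) - \<mu> (a + \<Delta>t))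
        = cmod (exp (z * of_real \<Delta>t)) * cmod ((\<mu>num \<Delta>t k - \<mu> a) - (Q \<Delta>t a - J))"
      by (simp only: norm_mult[symmetric]) (simp only: algebra_simps)
    also have "\<dots> \<le> cmod ((\<mu>num \<Delta>t k - \<mu> a) - (Q \<Delta>t a - J))"
      using propagator by (simp add: mult_left_le_one_le)
    also have "\<dots> \<le> cmod (\<mu>num \<Delta>t k - \<mu> a) + cmod (Q \<Delta>t a - J)"
      by (rule norm_triangle_ineq4)
    also have "cmod (Q \<Delta>t a - J) \<le> C * \<Delta>t ^ (p + 1)"
      using quadrature[rule_format, of \<Delta>t k] dt Suc.prems by (simp add: J_def z_def f_def a_def)
    also have "cmod (\<mu>num \<Delta>t k - \<mu> a) \<le> real k * (C * \<Delta>t ^ (p + 1))"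
      using Suc.IH a dt by (simp add: a_def)
    finally show ?case
      unfolding a(3) by (simp add: algebra_simps)
  qed
  \<comment> \<open>One power of the step size turns the number of steps into elapsed time, which is
    at most \<open>T\<close>; replacing it by \<open>T\<close> uses the sign of
    \<open>C\<close>.\<close>
  also have "real k * (C * \<Delta>t ^ (p + 1)) = (real k * \<Delta>t) * (C * \<Delta>t ^ p)"
    by simp
  also have "\<dots> \<le> T * (C * \<Delta>t ^ p)"
    using kT C dt by (intro mult_right_mono) auto
  finally show "cmod (\<mu>num \<Delta>t k - \<mu> (real k * \<Delta>t)) \<le> T * C * \<Delta>t ^ p"
    using kT by (simp add: mult.assoc)
qed

end
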